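(* Let $s\geq t\geq 1$ be integers. Suppose the $r$-regular graph $G$ has $H=K_{t,s}$ as a star complement for an eigenvalue $\mu\notin\{-1,-t,r\}$, with star set $X$, and all vertices of $X$ are of type $(0,b)$ (for some $b$). Then one of the following holds: (1) $\mu=-r$, $r=s=t+1$ and $G\cong K_{t+1,t+1}$; (2) $\mu=\frac12(-1\pm\sqrt5)$, $t=1$, $r=s=2$ and $G$ is a $5$-cycle; (3) $\mu$ is a positive integer, $r=s$, and $G$ is an $r$-regular graph of order $\mu(\mu+2t+1)(\mu^2+2t\mu+\mu+t^2-t)/t^2$, where $r=\mu(\mu^2+2t\mu+\mu+t^2)/t$.
   Context: All graphs are finite and simple; eigenvalues are eigenvalues of the adjacency matrix. If $\mu$ is an eigenvalue of $G$ with multiplicity $k\ge1$, a star set for $\mu$ is $X\subseteq V(G)$ with $|X|=k$ such that $\mu$ is not an eigenvalue of the induced subgraph $G-X$; $H=G-X$ is a star complement for $\mu$. Here $G-X\cong K_{t,s}$ with bipartition $(V,W)$, $|V|=t$, $|W|=s$. A vertex $u\in X$ is of type $(a,b)$ if it has exactly $a$ neighbours in $V$ and exactly $b$ neighbours in $W$. *)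

theory Defs
  imports
    "Graph_Theory.Graph_Theory"
    "Jordan_Normal_Form.Char_Poly"
    "Jordan_Normal_Form.Matrix_Kernel"
begin

text \<open>
  Finite simple graphs are the symmetric digraphs of locale \<^locale>\<open>graph\<close>: finite, loop-free and
  without parallel arcs. Each undirected edge is a pair of opposite arcs, so \<^const>\<open>out_degree\<close>
  is the undirected degree.
\<close>

definition regular_graph :: "('a, 'b) pre_digraph \<Rightarrow> nat \<Rightarrow> bool" where
  "regular_graph G r \<longleftrightarrow> graph G \<and> (\<forall>v \<in> verts G. out_degree G v = r)"

definition cycle_graph :: "nat \<Rightarrow> ('a, 'b) pre_digraph \<Rightarrow> bool" where
  "cycle_graph n G \<longleftrightarrow> graph G \<and> n \<ge> 3 \<and>
     (\<exists>c. bij_betw c {..<n} (verts G) \<and>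
          arcs_ends G = (\<Union>i<n. {(c i, c ((i + 1) mod n)), (c ((i + 1) mod n), c i)}))"

definition complete_bipartition :: "('a, 'b) pre_digraph \<Rightarrow> 'a set \<Rightarrow> 'a set \<Rightarrow> bool" where
  "complete_bipartition H V W \<longleftrightarrow>
     verts H = V \<union> W \<and> V \<inter> W = {} \<and> arcs_ends H = V \<times> W \<union> W \<times> V"

lemma complete_bipartite_digraph_iff_complete_bipartition:
  "complete_bipartite_digraph m n H \<longleftrightarrow>
     graph H \<and> (\<exists>V W. complete_bipartition H V W \<and> card V = m \<and> card W = n)"
  unfolding complete_bipartite_digraph_def complete_bipartition_def by blast

text \<open>
  The adjacency matrix is taken with respect to an arbitrary enumeration of the vertices;
  another enumeration gives a permutation-similar matrix, so the spectrum and the multiplicities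
  do not depend on this choice. Adjacency matrices are real symmetric, so all their eigenvalues
  are real.
\<close>

definition vertex_list :: "('a, 'b) pre_digraph \<Rightarrow> 'a list" where
  "vertex_list G = (SOME vs. distinct vs \<and> set vs = verts G)"

definition adjacency_matrix :: "('a, 'b) pre_digraph \<Rightarrow> real mat" where
  "adjacency_matrix G =
     mat (card (verts G)) (card (verts G))
       (\<lambda>(i, j). if vertex_list G ! i \<rightarrow>\<^bsub>G\<^esub> vertex_list G ! j then 1 else 0)"

definition graph_eigenvalue :: "('a, 'b) pre_digraph \<Rightarrow> real \<Rightarrow> bool" where
  "graph_eigenvalue G \<mu> \<longleftrightarrow> eigenvalue (adjacency_matrix G) \<mu>"

text \<open>
  The multiplicity is the dimension of the eigenspace, i.e. of the kernel of \<open>A - \<mu>I\<close>.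
  As \<open>A\<close> is symmetric, this is also the multiplicity of \<open>\<mu>\<close> as a root of the characteristic
  polynomial.
\<close>

definition eigenvalue_multiplicity :: "('a, 'b) pre_digraph \<Rightarrow> real \<Rightarrow> nat" where
  "eigenvalue_multiplicity G \<mu> = kernel_dim (char_matrix (adjacency_matrix G) \<mu>)"

abbreviation delete_verts :: "('a, 'b) pre_digraph \<Rightarrow> 'a set \<Rightarrow> ('a, 'b) pre_digraph" where
  "delete_verts G X \<equiv> G \<restriction> (verts G - X)"

definition star_set :: "('a, 'b) pre_digraph \<Rightarrow> real \<Rightarrow> 'a set \<Rightarrow> bool" where
  "star_set G \<mu> X \<longleftrightarrow>
     graph_eigenvalue G \<mu> \<and> X \<subseteq> verts G \<and>
     card X = eigenvalue_multiplicity G \<mu> \<and>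
     \<not> graph_eigenvalue (delete_verts G X) \<mu>"

definition vertex_of_type ::
  "('a, 'b) pre_digraph \<Rightarrow> 'a set \<Rightarrow> 'a set \<Rightarrow> 'a \<Rightarrow> nat \<times> nat \<Rightarrow> bool" where
  "vertex_of_type G V W u ab \<longleftrightarrow>
     card {v \<in> V. u \<rightarrow>\<^bsub>G\<^esub> v} = fst ab \<and> card {w \<in> W. u \<rightarrow>\<^bsub>G\<^esub> w} = snd ab"

end

theory Submission
  imports Defs
begin

text \<open>
  The eigenspace of \<open>\<mu>\<close> projects isomorphically onto the functions on the star set \<open>X\<close>. The
  eigenfunction restricting to the indicator of \<open>u \<in> X\<close> is constant on \<open>V\<close> and orthogonal to the
  constants, and evaluating it gives \<open>b = \<mu> (\<mu> + t)\<close>, \<open>t s = \<mu> (\<mu> + t)\<^sup>2 + \<mu>\<^sup>2\<close> and, for distinct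
  \<open>u, x \<in> X\<close>, exactly \<open>\<mu> (t - a)\<close> common neighbours in \<open>W\<close>, where \<open>a\<close> is 1 or 0 according to
  whether \<open>u\<close> and \<open>x\<close> are adjacent. If \<open>t - a > 0\<close> for some pair, then \<open>\<mu>\<close> is rational and a root
  of a monic integral polynomial, hence a positive integer. Otherwise either \<open>X\<close> is a single
  vertex, or \<open>t = 1\<close> and \<open>X\<close> is a clique whose members share no neighbour in \<open>W\<close>, which leaves
  only the 5-cycle.
\<close>

section \<open>Linear algebra: prescribing entries of kernel vectors\<close>

text \<open>Restriction to the coordinates in \<open>I\<close> is an injective linear map from the
  kernel to a space of the same dimension, hence onto. In coordinates this is the invertibility of a
  square matrix.\<close>

lemma mat_kernel_prescribed_entries:
  fixes A :: "'a :: field mat"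
  assumes A: "A \<in> carrier_mat n n" and I: "I \<subseteq> {..<n}" and card: "card I = kernel_dim A"
    and inj: "\<And>v. v \<in> mat_kernel A \<Longrightarrow> \<forall>i\<in>I. v $ i = 0 \<Longrightarrow> v = 0\<^sub>v n"
  shows "\<exists>v \<in> mat_kernel A. \<forall>i\<in>I. v $ i = g i"
proof -
  interpret K: kernel n n A by unfold_locales (rule A)
  obtain B where B: "finite B" "K.basis B" using kernel_basis_exists[OF A] by blast
  from B(2) have lin: "K.lin_indpt B" and sub: "B \<subseteq> mat_kernel A" by (auto simp: K.Ker.basis_def)
  define k where "k = card B"
  have "kernel_dim A = k" using K.Ker.dim_basis[OF B] by (simp add: k_def)
  with card have cI: "card I = k" by simp
  have finI: "finite I" using I finite_subset by blast
  obtain h where h: "bij_betw h {..<k} B"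
    using ex_bij_betw_nat_finite[OF B(1)] by (auto simp: k_def atLeast0LessThan)
  obtain e where e: "bij_betw e {..<k} I"
    using ex_bij_betw_nat_finite[OF finI] by (auto simp: cI atLeast0LessThan)
  \<comment> \<open>Column \<open>j\<close> holds the entries of the \<open>j\<close>-th basis
    vector at the positions in \<open>I\<close>, so \<open>M\<close> is the restriction map in
    coordinates.\<close>
  define M where "M = mat k k (\<lambda>(i, j). h j $ e i)"
  have M: "M \<in> carrier_mat k k" by (simp add: M_def)
  \<comment> \<open>The kernel vector with coordinate vector \<open>c\<close>;
    \<open>the_inv_into\<close> turns a basis vector back into its index.\<close>
  define L where "L c = K.lincomb (\<lambda>x. c $ the_inv_into {..<k} h x) B" for c
  have Lker: "L c \<in> mat_kernel A" for c
    unfolding L_def using K.Ker.lincomb_closed[OF sub] by auto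
  have Lcoeff: "(\<lambda>x. c $ the_inv_into {..<k} h x) (h j) = c $ j" if "j < k" for c :: "'a vec" and j
    using that h by (simp add: the_inv_into_f_f bij_betw_def)
  have Lval: "L c $ e i = (M *\<^sub>v c) $ i" if "i < k" and c: "c \<in> carrier_vec k" for c i
  proof -
    have "e i \<in> I" using e that by (auto simp: bij_betw_def)
    then have "e i < n" using I by auto
    then have "L c $ e i = (\<Sum>x\<in>B. c $ the_inv_into {..<k} h x * x $ e i)"
      unfolding L_def by (rule K.lincomb_index[OF _ sub])
    also have "\<dots> = (\<Sum>j<k. c $ j * h j $ e i)"
      using sum.reindex_bij_betw[OF h, of "\<lambda>x. c $ the_inv_into {..<k} h x * x $ e i"] Lcoeff by simp
    also have "\<dots> = (M *\<^sub>v c) $ i"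
      using that c by (simp add: M_def scalar_prod_def atLeast0LessThan mult.commute)
    finally show ?thesis .
  qed
  \<comment> \<open>A nonzero null vector of \<open>M\<close> would give a nontrivial combination of
    basis vectors vanishing on \<open>I\<close>, which is zero by \<open>inj\<close>, against linear
    independence.\<close>
  have "det M \<noteq> 0"
  proof
    assume "det M = 0"
    then obtain c where c: "c \<in> carrier_vec k" "c \<noteq> 0\<^sub>v k" "M *\<^sub>v c = 0\<^sub>v k"
      using det_0_iff_vec_prod_zero_field[OF M] by blast
    have "\<forall>i\<in>I. L c $ i = 0"
    proof
      fix i assume "i \<in> I"
      then obtain j where "j < k" "i = e j" using e by (auto simp: bij_betw_def)
      then show "L c $ i = 0" using Lval[OF _ c(1)] c(3) by simp
    qed
    then have L0: "L c = 0\<^sub>v n" using inj Lker by blast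
    from c obtain j where j: "j < k" "c $ j \<noteq> 0"
      by (metis carrier_vecD eq_vecI index_zero_vec)
    have "K.lin_dep B"
      by (rule K.Ker.lin_dep_crit[OF B(1) subset_refl, of "\<lambda>x. c $ the_inv_into {..<k} h x" "h j"])
        (use j h L0 Lcoeff in \<open>auto simp: L_def bij_betw_def\<close>)
    with lin show False by simp
  qed
  then have "M \<in> Units (ring_mat TYPE('a) k ())" by (rule det_non_zero_imp_unit[OF M])
  then obtain N where N: "N \<in> carrier_mat k k" "M * N = 1\<^sub>m k"
    by (auto simp: Units_def ring_mat_def)
  define c where "c = N *\<^sub>v vec k (\<lambda>i. g (e i))"
  have c: "c \<in> carrier_vec k" using N by (simp add: c_def)
  have "M *\<^sub>v c = vec k (\<lambda>i. g (e i))"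
    unfolding c_def using assoc_mult_mat_vec[OF M N(1), of "vec k (\<lambda>i. g (e i))"] N(2) by simp
  then have "\<forall>i\<in>I. L c $ i = g i"
    using Lval[OF _ c] e by (auto simp: bij_betw_def)
  with Lker show ?thesis by blast
qed

section \<open>Eigenvalues of graphs through functions on the vertices\<close>

definition adj_eigenfun :: "('a, 'b) pre_digraph \<Rightarrow> real \<Rightarrow> ('a \<Rightarrow> real) \<Rightarrow> bool" where
  "adj_eigenfun G \<mu> f \<longleftrightarrow> (\<forall>v \<in> verts G. (\<Sum>w \<in> {w \<in> verts G. v \<rightarrow>\<^bsub>G\<^esub> w}. f w) = \<mu> * f v)"

lemma vertex_list:
  assumes "finite (verts G)"
  shows "bij_betw (nth (vertex_list G)) {..<card (verts G)} (verts G)"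
proof -
  have "distinct (vertex_list G) \<and> set (vertex_list G) = verts G"
    unfolding vertex_list_def by (rule someI_ex) (use finite_distinct_list[OF assms] in blast)
  then show ?thesis by (metis bij_betw_nth distinct_card)
qed

lemma adjacency_matrix_carrier:
  "adjacency_matrix G \<in> carrier_mat (card (verts G)) (card (verts G))"
  by (simp add: adjacency_matrix_def)

text \<open>Links the matrix kernel, where the multiplicity is measured, with functions on the
  vertices. That every kernel vector arises from such a function is
  \<open>carrier_vec_vertex_fun\<close>.\<close>

lemma mat_kernel_adjacency_iff:
  assumes fin: "finite (verts G)"
  shows "vec (card (verts G)) (\<lambda>i. f (vertex_list G ! i))
      \<in> mat_kernel (char_matrix (adjacency_matrix G) \<mu>) \<longleftrightarrow> adj_eigenfun G \<mu> f"
proof -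
  define n where "n = card (verts G)"
  define x where "x = vertex_list G"
  note bij = vertex_list[OF fin, folded n_def x_def]
  let ?A = "char_matrix (adjacency_matrix G) \<mu>" and ?v = "vec n (\<lambda>i. f (x ! i))"
  note carr = adjacency_matrix_carrier[of G, folded n_def]
  have A: "?A \<in> carrier_mat n n" using carr by simp
  have entry: "(?A *\<^sub>v ?v) $ i = (\<Sum>w \<in> {w \<in> verts G. x ! i \<rightarrow>\<^bsub>G\<^esub> w}. f w) - \<mu> * f (x ! i)"
    if i: "i < n" for i
  proof -
    have "(?A *\<^sub>v ?v) $ i = (\<Sum>j<n. ?A $$ (i, j) * f (x ! j))"
      using A i by (simp add: scalar_prod_def atLeast0LessThan)
    also have "\<dots> = (\<Sum>j<n. (if x ! i \<rightarrow>\<^bsub>G\<^esub> x ! j then f (x ! j) else 0)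
        - (if j = i then \<mu> * f (x ! j) else 0))"
      using i carr by (intro sum.cong)
        (auto simp: char_matrix_def adjacency_matrix_def algebra_simps simp flip: n_def x_def)
    also have "\<dots> = (\<Sum>j<n. if x ! i \<rightarrow>\<^bsub>G\<^esub> x ! j then f (x ! j) else 0) - \<mu> * f (x ! i)"
      using i by (simp add: sum_subtractf)
    also have "(\<Sum>j<n. if x ! i \<rightarrow>\<^bsub>G\<^esub> x ! j then f (x ! j) else 0)
        = (\<Sum>w\<in>verts G. if x ! i \<rightarrow>\<^bsub>G\<^esub> w then f w else 0)"
      by (rule sum.reindex_bij_betw[OF bij])
    also have "\<dots> = (\<Sum>w \<in> {w \<in> verts G. x ! i \<rightarrow>\<^bsub>G\<^esub> w}. f w)"
      using fin by (simp add: sum.inter_filter)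
    finally show ?thesis .
  qed
  have "?v \<in> mat_kernel ?A \<longleftrightarrow> (\<forall>i<n. (?A *\<^sub>v ?v) $ i = 0)"
  proof -
    have "?v \<in> mat_kernel ?A \<longleftrightarrow> ?A *\<^sub>v ?v = 0\<^sub>v n" by (simp add: mat_kernel[OF A])
    also have "\<dots> \<longleftrightarrow> (\<forall>i<n. (?A *\<^sub>v ?v) $ i = 0)"
      using A by (auto simp: vec_eq_iff)
    finally show ?thesis .
  qed
  also have "\<dots> \<longleftrightarrow> (\<forall>i<n. (\<Sum>w \<in> {w \<in> verts G. x ! i \<rightarrow>\<^bsub>G\<^esub> w}. f w) = \<mu> * f (x ! i))"
    using entry by simp
  also have "\<dots> \<longleftrightarrow> adj_eigenfun G \<mu> f"
  proof -
    have img: "verts G = nth x ` {..<n}" using bij by (simp add: bij_betw_def)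
    show ?thesis unfolding adj_eigenfun_def by (subst (2) img) auto
  qed
  finally show ?thesis by (simp add: n_def x_def)
qed

lemma carrier_vec_vertex_fun:
  assumes fin: "finite (verts G)" and v: "v \<in> carrier_vec (card (verts G))"
  shows "\<exists>f. v = vec (card (verts G)) (\<lambda>i. f (vertex_list G ! i))"
proof -
  let ?x = "nth (vertex_list G)"
  have "v = vec (card (verts G)) (\<lambda>i. v $ (the_inv_into {..<card (verts G)} ?x (?x i)))"
    using v vertex_list[OF fin] by (intro eq_vecI) (auto simp: bij_betw_def the_inv_into_f_f)
  then show ?thesis
    by (intro exI[of _ "\<lambda>y. v $ the_inv_into {..<card (verts G)} ?x y"])
qed

lemma graph_eigenvalue_iff:
  assumes fin: "finite (verts G)"
  shows "graph_eigenvalue G \<mu> \<longleftrightarrow> (\<exists>f. adj_eigenfun G \<mu> f \<and> (\<exists>v\<in>verts G. f v \<noteq> 0))"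
proof -
  let ?n = "card (verts G)" and ?A = "char_matrix (adjacency_matrix G) \<mu>"
  let ?vec = "\<lambda>f. vec ?n (\<lambda>i. f (vertex_list G ! i))"
  have A: "?A \<in> carrier_mat ?n ?n" using adjacency_matrix_carrier[of G] by simp
  have zero: "?vec f = 0\<^sub>v ?n \<longleftrightarrow> (\<forall>v\<in>verts G. f v = 0)" for f :: "'a \<Rightarrow> real"
  proof -
    have img: "verts G = nth (vertex_list G) ` {..<?n}"
      using vertex_list[OF fin] by (simp add: bij_betw_def)
    show ?thesis by (subst img) (auto simp: vec_eq_iff)
  qed
  have "graph_eigenvalue G \<mu> \<longleftrightarrow> (\<exists>v. v \<in> mat_kernel ?A \<and> v \<noteq> 0\<^sub>v ?n)"
    unfolding graph_eigenvalue_def eigenvalue_char_matrix[OF adjacency_matrix_carrier] mat_kernel[OF A]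
    by auto
  also have "\<dots> \<longleftrightarrow> (\<exists>f. ?vec f \<in> mat_kernel ?A \<and> ?vec f \<noteq> 0\<^sub>v ?n)"
    using carrier_vec_vertex_fun[OF fin] mat_kernelD(1)[OF A] by metis
  finally show ?thesis by (simp add: zero mat_kernel_adjacency_iff[OF fin])
qed

lemma dominates_induce_subgraph_iff:
  "u \<rightarrow>\<^bsub>G \<restriction> S\<^esub> v \<longleftrightarrow> u \<in> S \<and> v \<in> S \<and> u \<rightarrow>\<^bsub>G\<^esub> v"
  by (auto simp: arcs_ends_conv)

text \<open>Vertices where \<open>f\<close> vanishes add nothing to a neighbour sum, so deleting
  them leaves the equations at the other vertices intact.\<close>

lemma adj_eigenfun_delete_verts:
  assumes fin: "finite (verts G)" and "adj_eigenfun G \<mu> f" and "\<forall>u\<in>X. f u = 0"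
  shows "adj_eigenfun (delete_verts G X) \<mu> f"
  unfolding adj_eigenfun_def
proof
  fix v assume v: "v \<in> verts (delete_verts G X)"
  have "(\<Sum>w \<in> {w \<in> verts (delete_verts G X). v \<rightarrow>\<^bsub>delete_verts G X\<^esub> w}. f w)
      = (\<Sum>w \<in> {w \<in> verts G. v \<rightarrow>\<^bsub>G\<^esub> w}. f w)"
    using v fin assms(3)
    by (intro sum.mono_neutral_left) (auto simp: dominates_induce_subgraph_iff)
  then show "(\<Sum>w \<in> {w \<in> verts (delete_verts G X). v \<rightarrow>\<^bsub>delete_verts G X\<^esub> w}. f w) = \<mu> * f v"
    using v assms(2) by (simp add: adj_eigenfun_def)
qed

section \<open>Star sets\<close>

text \<open>An eigenfunction vanishing on \<open>X\<close> solves the equations of the star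
  complement, which lacks the eigenvalue \<mu>, so it is zero. Restriction to \<open>X\<close> is
  thus injective on the eigenspace, and onto because \<open>card X\<close> is the
  multiplicity.\<close>

lemma star_set_extend:
  assumes fin: "finite (verts G)" and star: "star_set G \<mu> X"
  shows "\<exists>f. adj_eigenfun G \<mu> f \<and> (\<forall>u\<in>X. f u = g u)"
proof -
  let ?n = "card (verts G)" and ?A = "char_matrix (adjacency_matrix G) \<mu>"
  let ?x = "nth (vertex_list G)"
  let ?vec = "\<lambda>f. vec ?n (\<lambda>i. f (vertex_list G ! i))"
  let ?I = "{i \<in> {..<?n}. ?x i \<in> X}"
  note bij = vertex_list[OF fin]
  have A: "?A \<in> carrier_mat ?n ?n" using adjacency_matrix_carrier[of G] by simp
  from star have X: "X \<subseteq> verts G" and cX: "card X = kernel_dim ?A"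
    and nev: "\<not> graph_eigenvalue (delete_verts G X) \<mu>"
    by (auto simp: star_set_def eigenvalue_multiplicity_def)
  have img: "?x ` ?I = X" using bij X by (auto simp: bij_betw_def)
  then have img0: "u \<in> X \<longleftrightarrow> u \<in> ?x ` ?I" for u by blast
  have "inj_on ?x ?I" using bij by (auto simp: bij_betw_def inj_on_def)
  then have cI: "card ?I = kernel_dim ?A" using card_image[of ?x ?I] cX by (simp only: img)
  have "\<exists>v \<in> mat_kernel ?A. \<forall>i\<in>?I. v $ i = g (?x i)"
  proof (rule mat_kernel_prescribed_entries[OF A _ cI])
    fix v assume v: "v \<in> mat_kernel ?A" and v0: "\<forall>i\<in>?I. v $ i = 0"
    obtain f where f: "v = ?vec f"
      using carrier_vec_vertex_fun[OF fin] mat_kernelD(1)[OF A v] by blast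
    have "adj_eigenfun G \<mu> f" using v f mat_kernel_adjacency_iff[OF fin] by blast
    moreover have fX: "\<forall>u\<in>X. f u = 0"
    proof
      fix u assume "u \<in> X"
      then obtain i where "i \<in> ?I" "u = ?x i" using img0 by blast
      then show "f u = 0" using v0 by (simp add: f)
    qed
    ultimately have "adj_eigenfun (delete_verts G X) \<mu> f"
      by (rule adj_eigenfun_delete_verts[OF fin])
    then have "\<forall>v \<in> verts G - X. f v = 0"
      using nev fin by (auto simp: graph_eigenvalue_iff)
    with fX have "\<forall>v \<in> verts G. f v = 0" by blast
    then show "v = 0\<^sub>v ?n" using bij by (auto simp: f vec_eq_iff bij_betw_def)
  qed auto
  then obtain v where v: "v \<in> mat_kernel ?A" "\<forall>i\<in>?I. v $ i = g (?x i)" by blast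
  obtain f where f: "v = ?vec f"
    using carrier_vec_vertex_fun[OF fin] mat_kernelD(1)[OF A v(1)] by blast
  have "adj_eigenfun G \<mu> f" using v(1) f mat_kernel_adjacency_iff[OF fin] by blast
  moreover have "\<forall>u\<in>X. f u = g u"
  proof
    fix u assume "u \<in> X"
    then obtain i where "i \<in> ?I" "u = ?x i" using img0 by blast
    then show "f u = g u" using v(2) by (simp add: f)
  qed
  ultimately show ?thesis by blast
qed

text \<open>For empty \<open>X\<close> the vanishing condition on \<open>X\<close> is vacuous, so an
  eigenfunction of \<open>G\<close> would survive in the star complement.\<close>

lemma star_set_nonempty:
  assumes fin: "finite (verts G)" and star: "star_set G \<mu> X"
  shows "X \<noteq> {}"
proof
  assume "X = {}"
  moreover obtain f v where "adj_eigenfun G \<mu> f" "v \<in> verts G" "f v \<noteq> 0"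
    using star fin by (auto simp: star_set_def graph_eigenvalue_iff)
  ultimately have "graph_eigenvalue (delete_verts G X) \<mu>"
    using adj_eigenfun_delete_verts[OF fin, of \<mu> f X] fin by (auto simp: graph_eigenvalue_iff)
  with star show False by (simp add: star_set_def)
qed

section \<open>Regular graphs: degrees and orthogonality to the constants\<close>

lemma (in graph) out_degree_eq_card_neighbours:
  "out_degree G v = card {w \<in> verts G. v \<rightarrow>\<^bsub>G\<^esub> w}"
proof -
  have "head G ` out_arcs G v = {w \<in> verts G. v \<rightarrow>\<^bsub>G\<^esub> w}"
    by (auto simp: arcs_ends_conv)
  moreover have "inj_on (head G) (out_arcs G v)"
    using no_multi_arcs by (auto simp: inj_on_def arc_to_ends_def)
  ultimately show ?thesis unfolding out_degree_def by (metis card_image)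
qed

text \<open>Eigenspaces for different eigenvalues are orthogonal, and the constant functions are
  eigenfunctions of a regular graph.\<close>

lemma regular_adj_eigenfun_sum:
  assumes reg: "regular_graph G r" and f: "adj_eigenfun G \<mu> f" and "\<mu> \<noteq> real r"
  shows "(\<Sum>v\<in>verts G. f v) = 0"
proof -
  interpret g: graph G using reg by (simp add: regular_graph_def)
  have sym: "u \<rightarrow>\<^bsub>G\<^esub> v \<longleftrightarrow> v \<rightarrow>\<^bsub>G\<^esub> u" for u v
    using g.sym_arcs by (auto intro: arcs_ends_symmetric)
  have "\<mu> * (\<Sum>v\<in>verts G. f v) = (\<Sum>v\<in>verts G. \<Sum>w \<in> {w \<in> verts G. v \<rightarrow>\<^bsub>G\<^esub> w}. f w)"
    using f by (simp add: adj_eigenfun_def sum_distrib_left)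
  also have "\<dots> = (\<Sum>w\<in>verts G. \<Sum>v \<in> {v \<in> verts G. v \<rightarrow>\<^bsub>G\<^esub> w}. f w)"
    by (rule sum.swap_restrict) auto
  also have "\<dots> = (\<Sum>w\<in>verts G. \<Sum>v \<in> {v \<in> verts G. w \<rightarrow>\<^bsub>G\<^esub> v}. f w)"
    using sym by (intro sum.cong) auto
  also have "\<dots> = (\<Sum>w\<in>verts G. real r * f w)"
    using reg by (intro sum.cong) (simp_all add: regular_graph_def g.out_degree_eq_card_neighbours)
  also have "\<dots> = real r * (\<Sum>v\<in>verts G. f v)" by (simp add: sum_distrib_left)
  finally show ?thesis using assms(3) by simp
qed

section \<open>Numerical relations obtained from one eigenfunction\<close>

text \<open>Here \<open>N\<close> is adjacency and \<open>f\<close> the eigenfunction that is the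
  indicator of \<open>u\<close> on \<open>X\<close>. \<open>fV\<close>, \<open>fW\<close> and
  \<open>fX\<close> are its equations at the three kinds of vertices, without terms between
  \<open>V\<close> and \<open>X\<close> because of the type, and \<open>sum0\<close> is
  orthogonality to the constants. The proof eliminates \<open>f\<close> in favour of its sum
  \<open>p\<close> over \<open>V\<close>, and then \<open>p\<close> itself.\<close>

lemma type_zero_relations:
  fixes V W X :: "'a set" and N :: "'a \<Rightarrow> 'a \<Rightarrow> bool" and f :: "'a \<Rightarrow> real" and \<mu> :: real
  assumes fin: "finite V" "finite W" and card: "card V = t" "card W = s" and pos: "t > 0" "s > 0"
    and fV: "\<And>v. v \<in> V \<Longrightarrow> (\<Sum>w\<in>W. f w) = \<mu> * f v"
    and fW: "\<And>w. w \<in> W \<Longrightarrow> (\<Sum>v\<in>V. f v) + of_bool (N u w) = \<mu> * f w"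
    and fX: "\<And>x. x \<in> X \<Longrightarrow> (\<Sum>w \<in> {w \<in> W. N x w}. f w) + of_bool (N x u) = \<mu> * of_bool (x = u)"
    and sum0: "(\<Sum>v\<in>V. f v) + (\<Sum>w\<in>W. f w) + 1 = 0"
    and u: "u \<in> X" "\<not> N u u" and b: "\<And>x. x \<in> X \<Longrightarrow> card {w \<in> W. N x w} = b"
    and \<mu>t: "\<mu> \<noteq> - real t"
  shows "b > 0" and "real b * (real t + \<mu>) = real t * real s - \<mu>\<^sup>2"
    and "\<mu> \<noteq> 0 \<Longrightarrow> real b = \<mu> * (\<mu> + real t)"
    and "\<mu> \<noteq> 0 \<Longrightarrow> x \<in> X \<Longrightarrow> x \<noteq> u \<Longrightarrow>
      real (card {w \<in> W. N x w \<and> N u w}) = \<mu> * (real t - of_bool (N x u))"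
proof -
  define p where "p = (\<Sum>v\<in>V. f v)"
  define q where "q = (\<Sum>w\<in>W. f w)"
  have pq: "q = - 1 - p" using sum0 by (simp add: p_def q_def)
  have "real t * q = (\<Sum>v\<in>V. \<mu> * f v)"
    using card sum.cong[OF refl fV, of V "\<lambda>v. v"] by (simp add: q_def)
  then have tq: "real t * q = \<mu> * p" by (simp add: p_def sum_distrib_left)
  \<comment> \<open>Kept as a product: below, equations are multiplied by
    \<open>\<mu> + real t\<close> to eliminate \<open>p\<close> without division.\<close>
  then have p: "p * (\<mu> + real t) = - real t" by (simp add: pq algebra_simps)
  have cnt: "(\<Sum>w\<in>S. of_bool (N u w)) = real (card {w \<in> S. N u w})" if "finite S" for S
    using that by (simp add: Int_def)
  have "\<mu> * q = (\<Sum>w\<in>W. p + of_bool (N u w))"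
    using fW by (simp add: q_def p_def sum_distrib_left)
  also have "\<dots> = real s * p + real b"
    using cnt[OF fin(2)] b[OF u(1)] card by (simp add: sum.distrib)
  finally have sp: "\<mu> * q = real s * p + real b" .
  \<comment> \<open>The equation at \<open>x\<close> is multiplied by \<mu>, so that each
    \<open>\<mu> * f w\<close> can be replaced by \<open>p + of_bool (N u w)\<close>; the sum then
    counts common neighbours.\<close>
  have c: "real (card {w \<in> W. N x w \<and> N u w})
      = \<mu> * (\<mu> * of_bool (x = u) - of_bool (N x u)) - real b * p" if x: "x \<in> X" for x
  proof -
    have fin': "finite {w \<in> W. N x w}" using fin by simp
    have "\<mu> * (\<mu> * of_bool (x = u) - of_bool (N x u)) = \<mu> * (\<Sum>w \<in> {w \<in> W. N x w}. f w)"
      using fX[OF x] by simp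
    also have "\<dots> = (\<Sum>w \<in> {w \<in> W. N x w}. p + of_bool (N u w))"
      using fW by (simp add: p_def sum_distrib_left)
    also have "\<dots> = real b * p + real (card {w \<in> {w \<in> W. N x w}. N u w})"
      using cnt[OF fin'] b[OF x] by (simp only: sum.distrib sum_constant)
    finally show ?thesis by (simp add: conj_assoc)
  qed
  \<comment> \<open>Without neighbours in \<open>W\<close> the equation at \<open>u\<close> reads
    \<mu> = 0; then \<open>p\<close> and \<open>q\<close> both vanish, although they add up to
    -1.\<close>
  show "b > 0"
  proof (rule ccontr)
    assume "\<not> b > 0"
    then have "{w \<in> W. N u w} = {}" using b[OF u(1)] fin by (simp add: card_eq_0_iff)
    then have "\<mu> = 0" using fX[OF u(1)] u(2) by (simp only: sum.empty) simp
    then have "q = 0" "p = 0" using tq sp pos \<open>\<not> b > 0\<close> by auto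
    with pq show False by simp
  qed
  have "(\<mu> * q) * (\<mu> + real t) = (real s * p + real b) * (\<mu> + real t)" by (simp add: sp)
  then have "\<mu> * (- (\<mu> + real t) - p * (\<mu> + real t))
      = real s * (p * (\<mu> + real t)) + real b * (\<mu> + real t)"
    by (simp add: pq algebra_simps)
  then show "real b * (real t + \<mu>) = real t * real s - \<mu>\<^sup>2"
    unfolding p by (simp add: algebra_simps power2_eq_square)
  assume \<mu>0: "\<mu> \<noteq> 0"
  \<comment> \<open>This is \<open>c\<close> at \<open>x = u\<close>: a vertex shares all its
    \<open>b\<close> neighbours in \<open>W\<close> with itself.\<close>
  have "real b = \<mu>\<^sup>2 - real b * p" using c[OF u(1)] b[OF u(1)] u(2) by (simp add: power2_eq_square)
  then have "real b * (\<mu> + real t) = \<mu>\<^sup>2 * (\<mu> + real t) - real b * (p * (\<mu> + real t))"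
    by (metis left_diff_distrib mult.assoc)
  then have "\<mu> * real b = \<mu> * (\<mu> * (\<mu> + real t))"
    unfolding p by (simp add: algebra_simps power2_eq_square)
  then show b_eq: "real b = \<mu> * (\<mu> + real t)" using \<mu>0 by simp
  then have "real b * p = \<mu> * (p * (\<mu> + real t))" by simp
  then have "real b * p = - \<mu> * real t" unfolding p by simp
  then show "real (card {w \<in> W. N x w \<and> N u w}) = \<mu> * (real t - of_bool (N x u))"
    if "x \<in> X" "x \<noteq> u"
    using c[OF that(1)] that(2) by (simp add: algebra_simps)
qed

text \<open>Rational root theorem: clearing denominators makes the reduced denominator
  \<open>n\<close> divide \<open>m * m\<close>, and coprimality makes it a unit.\<close>

lemma rational_monic_quadratic_root_Ints:
  fixes \<mu> :: real and a b :: int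
  assumes "\<mu> \<in> \<rat>" and "\<mu>\<^sup>2 + of_int a * \<mu> = of_int b"
  shows "\<mu> \<in> \<int>"
proof -
  obtain m n :: int where mn: "n > 0" "coprime m n" "\<mu> = of_int m / of_int n"
    using assms(1) by (metis Rats_cases')
  have "(real_of_int m)\<^sup>2 + of_int a * of_int m * of_int n = of_int b * (of_int n)\<^sup>2"
    using assms(2) mn(1) unfolding mn(3) by (simp add: field_simps power2_eq_square)
  then have "m * m = n * (b * n - a * m)"
    by (simp add: algebra_simps power2_eq_square flip: of_int_mult of_int_add)
  then have "n dvd m * m" by (metis dvd_triv_left)
  then have "is_unit n" using mn(2) by (metis coprime_common_divisor coprime_mult_left_iff dvd_refl)
  then show ?thesis using mn by simp
qed

section \<open>Structure of the graph around the star complement\<close>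

locale type_zero_star_complement =
  fixes G :: "('a, 'b) pre_digraph" and X V W :: "'a set" and s t r b :: nat and \<mu> :: real
  assumes regular: "regular_graph G r" and star: "star_set G \<mu> X"
    and bipartition: "complete_bipartition (delete_verts G X) V W"
    and card_V: "card V = t" and card_W: "card W = s" and t_pos: "t > 0" and s_pos: "s > 0"
    and \<mu>_neq: "\<mu> \<noteq> - real t" "\<mu> \<noteq> real r"
    and type0: "\<And>u. u \<in> X \<Longrightarrow> vertex_of_type G V W u (0, b)"
begin

abbreviation adjacent :: "'a \<Rightarrow> 'a \<Rightarrow> bool" (infix \<open>\<sim>\<close> 50)
  where "x \<sim> y \<equiv> dominates G x y"

lemma graph: "graph G"
  using regular by (simp add: regular_graph_def)

lemma X_subset: "X \<subseteq> verts G"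
  using star by (simp add: star_set_def)

lemma VW_partition: "verts G - X = V \<union> W" "V \<inter> W = {}"
    and arcs_ends_H: "arcs_ends (delete_verts G X) = V \<times> W \<union> W \<times> V"
  using bipartition unfolding complete_bipartition_def induce_subgraph_verts by blast+

lemma verts_eq: "verts G = V \<union> W \<union> X"
  using VW_partition X_subset by auto

lemma X_disjoint: "V \<inter> X = {}" "W \<inter> X = {}"
  using VW_partition by auto

lemma finite_verts: "finite (verts G)"
  by (rule fin_digraph.finite_verts) (use graph in \<open>simp add: graph_def digraph_def\<close>)

lemma finite_VWX: "finite V" "finite W" "finite X"
  using finite_verts by (simp_all add: verts_eq)

lemma sym: "x \<sim> y \<longleftrightarrow> y \<sim> x"
proof -
  interpret g: graph G by (rule graph)
  show ?thesis using g.sym_arcs by (auto intro: arcs_ends_symmetric)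
qed

lemma irrefl: "\<not> x \<sim> x"
proof -
  interpret g: graph G by (rule graph)
  show ?thesis using g.adj_not_same by blast
qed

lemma adjacent_in_verts:
  assumes "x \<sim> y" shows "x \<in> verts G" "y \<in> verts G"
proof -
  interpret g: graph G by (rule graph)
  show "x \<in> verts G" "y \<in> verts G" using g.adj_in_verts[OF assms] .
qed

lemma adjacent_VW_iff:
  assumes "x \<in> V \<union> W" "y \<in> V \<union> W"
  shows "x \<sim> y \<longleftrightarrow> x \<in> V \<and> y \<in> W \<or> x \<in> W \<and> y \<in> V"
proof -
  have "x \<sim> y \<longleftrightarrow> (x, y) \<in> arcs_ends (delete_verts G X)"
    using assms VW_partition(1) by (simp add: dominates_induce_subgraph_iff)
  then show ?thesis by (simp add: arcs_ends_H)
qed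

lemma not_adjacent_XV:
  assumes "u \<in> X" "v \<in> V" shows "\<not> u \<sim> v" "\<not> v \<sim> u"
proof -
  have "card {v \<in> V. u \<sim> v} = 0" using type0[OF assms(1)] by (simp add: vertex_of_type_def)
  then show "\<not> u \<sim> v" using finite_VWX assms(2) by (auto simp: card_eq_0_iff)
  then show "\<not> v \<sim> u" using sym by blast
qed

lemma card_XW: "u \<in> X \<Longrightarrow> card {w \<in> W. u \<sim> w} = b"
  using type0[of u] by (simp add: vertex_of_type_def)

lemma neighbours_V: "v \<in> V \<Longrightarrow> {y \<in> verts G. v \<sim> y} = W"
  using not_adjacent_XV(2)[of _ v] adjacent_VW_iff[of v] VW_partition(2) unfolding verts_eq by blast

lemma neighbours_W: "w \<in> W \<Longrightarrow> {y \<in> verts G. w \<sim> y} = V \<union> {x \<in> X. w \<sim> x}"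
  using adjacent_VW_iff[of w] VW_partition(2) unfolding verts_eq by blast

lemma neighbours_X: "x \<in> X \<Longrightarrow> {y \<in> verts G. x \<sim> y} = {w \<in> W. x \<sim> w} \<union> {y \<in> X. x \<sim> y}"
  using not_adjacent_XV(1)[of x] unfolding verts_eq by blast

lemma degree: "x \<in> verts G \<Longrightarrow> card {y \<in> verts G. x \<sim> y} = r"
  using regular graph.out_degree_eq_card_neighbours[OF graph, of x] by (simp add: regular_graph_def)

text \<open>The neighbourhood of a vertex of \<open>V\<close> is exactly \<open>W\<close>, since no
  vertex of \<open>X\<close> is joined to \<open>V\<close>.\<close>

lemma r_eq_s: "r = s"
proof -
  obtain v where "v \<in> V" using card_V t_pos by fastforce
  then show ?thesis using degree[of v] neighbours_V[of v] card_W verts_eq by simp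
qed

lemma degree_W:
  assumes "w \<in> W" shows "t + card {x \<in> X. w \<sim> x} = s"
proof -
  have "card (V \<union> {x \<in> X. w \<sim> x}) = s"
    using degree[of w] neighbours_W[OF assms] assms r_eq_s verts_eq by simp
  moreover have "card (V \<union> {x \<in> X. w \<sim> x}) = t + card {x \<in> X. w \<sim> x}"
    unfolding card_V[symmetric] using finite_VWX X_disjoint by (intro card_Un_disjoint) auto
  ultimately show ?thesis by simp
qed

text \<open>Double counting of the edges between \<open>X\<close> and \<open>W\<close>:
  \<open>b\<close> at each vertex of \<open>X\<close> and, by \<open>degree_W\<close>,
  \<open>s - t\<close> at each vertex of \<open>W\<close>.\<close>

lemma card_X_times_b:
  "card X * b = s * (s - t)"
proof -
  have "card X * b = (\<Sum>x\<in>X. \<Sum>w \<in> {w \<in> W. x \<sim> w}. 1)" using card_XW by simp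
  also have "\<dots> = (\<Sum>w\<in>W. \<Sum>x \<in> {x \<in> X. x \<sim> w}. 1)" by (rule sum.swap_restrict[OF finite_VWX(3,2)])
  also have "\<dots> = (\<Sum>w\<in>W. s - t)"
  proof (rule sum.cong[OF refl])
    fix w assume "w \<in> W"
    then show "(\<Sum>x \<in> {x \<in> X. x \<sim> w}. 1) = s - t" using degree_W[of w] sym[of w] by simp
  qed
  finally show ?thesis using card_W by simp
qed

lemma X_nonempty: "X \<noteq> {}"
  by (rule star_set_nonempty[OF finite_verts star])

text \<open>Prepares the premises of \<open>type_zero_relations\<close>:
  \<open>star_set_extend\<close> supplies the function, its equations split along the neighbourhoods
  found above, and its total vanishes because \<mu> differs from \<open>r\<close>.\<close>

lemma eigenfun_extending_indicator:
  assumes u: "u \<in> X"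
  shows "\<exists>f. (\<forall>v\<in>V. (\<Sum>w\<in>W. f w) = \<mu> * f v)
    \<and> (\<forall>w\<in>W. (\<Sum>v\<in>V. f v) + of_bool (u \<sim> w) = \<mu> * f w)
    \<and> (\<forall>x\<in>X. (\<Sum>w \<in> {w \<in> W. x \<sim> w}. f w) + of_bool (x \<sim> u) = \<mu> * of_bool (x = u))
    \<and> (\<Sum>v\<in>V. f v) + (\<Sum>w\<in>W. f w) + 1 = 0"
proof -
  obtain f where f: "adj_eigenfun G \<mu> f" and fX: "\<forall>x\<in>X. f x = of_bool (x = u)"
    using star_set_extend[OF finite_verts star, of "\<lambda>x. of_bool (x = u)"] by blast
  have ev: "(\<Sum>y \<in> {y \<in> verts G. x \<sim> y}. f y) = \<mu> * f x" if "x \<in> verts G" for x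
    using f that by (simp add: adj_eigenfun_def)
  have one: "(\<Sum>x\<in>S. f x) = of_bool (u \<in> S)" if "S \<subseteq> X" for S
  proof -
    have "finite S" using that finite_VWX finite_subset by blast
    moreover have "(\<Sum>x\<in>S. f x) = (\<Sum>x\<in>S. if x = u then 1 else 0)"
      using that fX by (intro sum.cong) auto
    ultimately show ?thesis by simp
  qed
  have "\<forall>v\<in>V. (\<Sum>w\<in>W. f w) = \<mu> * f v" using ev neighbours_V verts_eq by (metis UnCI)
  moreover have "(\<Sum>v\<in>V. f v) + of_bool (u \<sim> w) = \<mu> * f w" if w: "w \<in> W" for w
  proof -
    have "(\<Sum>y\<in>V \<union> {x \<in> X. w \<sim> x}. f y) = \<mu> * f w" using ev[of w] neighbours_W[OF w] w verts_eq by simp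
    then show ?thesis
      using finite_VWX X_disjoint one[of "{x \<in> X. w \<sim> x}"] u sym[of w u] by (subst (asm) sum.union_disjoint) auto
  qed
  moreover have "(\<Sum>w \<in> {w \<in> W. x \<sim> w}. f w) + of_bool (x \<sim> u) = \<mu> * of_bool (x = u)"
    if x: "x \<in> X" for x
  proof -
    have "(\<Sum>y\<in>{w \<in> W. x \<sim> w} \<union> {y \<in> X. x \<sim> y}. f y) = \<mu> * of_bool (x = u)"
      using ev[of x] neighbours_X[OF x] x verts_eq fX by simp
    then show ?thesis
      using finite_VWX X_disjoint one[of "{y \<in> X. x \<sim> y}"] u by (subst (asm) sum.union_disjoint) auto
  qed
  moreover have "(\<Sum>v\<in>V. f v) + (\<Sum>w\<in>W. f w) + 1 = 0"
  proof -
    have "(\<Sum>y\<in>(V \<union> W) \<union> X. f y) = 0"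
      using regular_adj_eigenfun_sum[OF regular f \<mu>_neq(2)] verts_eq by simp
    moreover have "(\<Sum>y\<in>(V \<union> W) \<union> X. f y) = (\<Sum>y\<in>V \<union> W. f y) + (\<Sum>y\<in>X. f y)"
      using finite_VWX X_disjoint by (intro sum.union_disjoint) auto
    moreover have "(\<Sum>y\<in>V \<union> W. f y) = (\<Sum>y\<in>V. f y) + (\<Sum>y\<in>W. f y)"
      using finite_VWX VW_partition by (intro sum.union_disjoint) auto
    ultimately show ?thesis using one[of X] u by simp
  qed
  ultimately show ?thesis by blast
qed

lemma star_relations:
  assumes u: "u \<in> X"
  shows "b > 0 \<and> real b * (real t + \<mu>) = real t * real s - \<mu>\<^sup>2 \<and>
      (\<mu> \<noteq> 0 \<longrightarrow> real b = \<mu> * (\<mu> + real t) \<and>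
        (\<forall>x\<in>X. x \<noteq> u \<longrightarrow>
          real (card {w \<in> W. x \<sim> w \<and> u \<sim> w}) = \<mu> * (real t - of_bool (x \<sim> u))))"
proof -
  obtain f where f: "\<forall>v\<in>V. (\<Sum>w\<in>W. f w) = \<mu> * f v"
    "\<forall>w\<in>W. (\<Sum>v\<in>V. f v) + of_bool (u \<sim> w) = \<mu> * f w"
    "\<forall>x\<in>X. (\<Sum>w \<in> {w \<in> W. x \<sim> w}. f w) + of_bool (x \<sim> u) = \<mu> * of_bool (x = u)"
    "(\<Sum>v\<in>V. f v) + (\<Sum>w\<in>W. f w) + 1 = 0"
    using eigenfun_extending_indicator[OF u] by blast
  note rels = type_zero_relations[of V W t s f \<mu> "(\<sim>)" u X b, OF finite_VWX(1,2) card_V card_W t_pos s_pos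
    f(1)[rule_format] f(2)[rule_format] f(3)[rule_format] f(4) u irrefl card_XW \<mu>_neq(1)]
  show ?thesis using rels by blast
qed

lemma b_pos: "b > 0" and quadratic_s: "real b * (real t + \<mu>) = real t * real s - \<mu>\<^sup>2"
  using star_relations X_nonempty by blast+

lemma card_X_pos: "card X > 0"
  using X_nonempty finite_VWX by (simp add: card_gt_0_iff)

text \<open>Some edge joins \<open>X\<close> to \<open>W\<close>, so the edge count
  \<open>s * (s - t)\<close> is positive.\<close>

lemma t_less_s: "t < s"
proof -
  have "s * (s - t) > 0" using card_X_times_b b_pos card_X_pos by (metis mult_pos_pos)
  then show ?thesis by simp
qed

text \<open>Two vertices of \<open>W\<close> have the same neighbours in the star complement, so the
  difference of their indicators is a null vector there, making 0 an eigenvalue of it.\<close>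

lemma \<mu>_nonzero:
  "\<mu> \<noteq> 0"
proof
  assume "\<mu> = 0"
  have "\<not> card W \<le> 1" using t_less_s t_pos card_W by linarith
  then obtain w1 w2 where w: "w1 \<in> W" "w2 \<in> W" "w1 \<noteq> w2"
    using finite_VWX(2) by (metis card_le_Suc0_iff_eq One_nat_def)
  define h where "h x = of_bool (x = w1) - (of_bool (x = w2) :: real)" for x
  have hW: "(\<Sum>x\<in>W. h x) = 0" using w finite_VWX(2) by (simp add: h_def sum_subtractf of_bool_def)
  have hV: "(\<Sum>x\<in>V. h x) = 0" using w VW_partition(2) by (intro sum.neutral) (auto simp: h_def)
  have "adj_eigenfun (delete_verts G X) 0 h"
    unfolding adj_eigenfun_def
  proof
    fix x assume "x \<in> verts (delete_verts G X)"
    then have x: "x \<in> V \<union> W" using VW_partition by simp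
    have "{y \<in> verts (delete_verts G X). x \<rightarrow>\<^bsub>delete_verts G X\<^esub> y} = (if x \<in> V then W else V)"
      using x VW_partition(2) unfolding arcs_ends_H unfolding induce_subgraph_verts VW_partition(1) by auto
    then show "(\<Sum>y \<in> {y \<in> verts (delete_verts G X). x \<rightarrow>\<^bsub>delete_verts G X\<^esub> y}. h y) = 0 * h x"
      using hV hW by simp
  qed
  moreover have "h w1 \<noteq> 0" "w1 \<in> verts (delete_verts G X)" using w VW_partition by (auto simp: h_def)
  ultimately have "graph_eigenvalue (delete_verts G X) 0"
    using finite_verts by (auto simp: graph_eigenvalue_iff)
  then show False using star \<open>\<mu> = 0\<close> by (simp add: star_set_def)
qed

lemma quadratic_b: "real b = \<mu> * (\<mu> + real t)"
  using star_relations X_nonempty \<mu>_nonzero by blast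

lemma common_neighbours:
  assumes "x \<in> X" "u \<in> X" "x \<noteq> u"
  shows "real (card {w \<in> W. x \<sim> w \<and> u \<sim> w}) = \<mu> * (real t - of_bool (x \<sim> u))"
  using star_relations[OF assms(2)] assms \<mu>_nonzero by blast

lemma card_verts: "card (verts G) = t + s + card X"
  using finite_VWX X_disjoint VW_partition(2) card_V card_W by (simp add: verts_eq card_Un_disjoint Int_Un_distrib2)

section \<open>The three kinds of star set\<close>

text \<open>A vertex of \<open>W\<close> has at most one neighbour in \<open>X\<close>, and
  \<open>t < s\<close> demands one. So \<open>s = t + 1\<close>, and the only vertex of
  \<open>X\<close> is joined to all of \<open>W\<close>, enlarging the side \<open>V\<close> by
  one.\<close>

lemma singleton_case:
  assumes True: "card X = 1"
  shows "\<mu> = - real r \<and> r = s \<and> s = t + 1 \<and> complete_bipartite_digraph (t + 1) (t + 1) G"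
proof -
  obtain u where Xu: "X = {u}" using True by (auto simp: card_1_singleton_iff)
  have "card {x \<in> X. w \<sim> x} \<le> 1" for w using card_mono[OF finite_VWX(3), of "{x \<in> X. w \<sim> x}"] True by auto
  moreover obtain w where "w \<in> W" using t_less_s card_W by fastforce
  ultimately have s: "s = t + 1" using degree_W[of w] t_less_s
    by (metis add_le_mono1 Suc_eq_plus1 add.commute le_antisym Suc_leI)
  then have bs: "b = s" using card_X_times_b True by simp
  have "{w \<in> W. u \<sim> w} = W" using card_XW[of u] bs card_W finite_VWX Xu
    by (metis (no_types, lifting) card_subset_eq mem_Collect_eq singletonI subsetI)
  then have NuW: "u \<sim> w" if "w \<in> W" for w using that by blast
  have "real t + 1 = \<mu> * (\<mu> + real t)" using quadratic_b bs s by simp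
  \<comment> \<open>The quadratic has the roots 1 and -(t + 1); the first contradicts
    \<open>quadratic_s\<close>.\<close>
  then have "(\<mu> - 1) * (\<mu> + real t + 1) = 0" by (simp add: algebra_simps)
  moreover have "\<mu> \<noteq> 1"
  proof
    assume "\<mu> = 1"
    then show False using quadratic_s by (simp add: bs s algebra_simps)
  qed
  ultimately have "\<mu> = - real r" using r_eq_s s by simp
  moreover have "complete_bipartition G (insert u V) W"
  proof -
    have "(x, y) \<in> arcs_ends G \<longleftrightarrow> (x, y) \<in> insert u V \<times> W \<union> W \<times> insert u V" for x y
    proof (cases "x \<in> verts G \<and> y \<in> verts G")
      case True
      then have "x \<in> V \<union> W \<or> x = u" "y \<in> V \<union> W \<or> y = u" by (auto simp: verts_eq Xu)
      moreover have "u \<notin> V" "u \<notin> W" "u \<in> X" using X_disjoint Xu by auto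
      ultimately show ?thesis
        using adjacent_VW_iff[of x y] NuW not_adjacent_XV[of u] sym irrefl VW_partition(2) by blast
    next
      case False
      then have "(x, y) \<notin> arcs_ends G" using adjacent_in_verts by blast
      with False show ?thesis by (auto simp: verts_eq Xu)
    qed
    then have "arcs_ends G = insert u V \<times> W \<union> W \<times> insert u V" by auto
    then show ?thesis using verts_eq Xu VW_partition(2) X_disjoint by (auto simp: complete_bipartition_def)
  qed
  moreover have "card (insert u V) = t + 1" using card_V finite_VWX X_disjoint Xu by auto
  ultimately have "complete_bipartite_digraph (t + 1) (t + 1) G"
    using graph card_W s by (auto simp: complete_bipartite_digraph_iff_complete_bipartition)
  with \<open>\<mu> = - real r\<close> r_eq_s s show ?thesis by blast
qed

text \<open>For this pair the factor of \<mu> in \<open>common_neighbours\<close> is positive, so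
  \<mu> is a quotient of natural numbers, and \<open>quadratic_b\<close> makes it an integer. Degree
  and order then follow from \<open>quadratic_s\<close> and \<open>card_X_times_b\<close>.\<close>

lemma integral_case:
  assumes xu: "x \<in> X" "u \<in> X" "x \<noteq> u" "t \<ge> 2 \<or> \<not> x \<sim> u"
  shows "(\<exists>m::nat. m > 0 \<and> \<mu> = real m) \<and> r = s \<and> regular_graph G r
        \<and> real (card (verts G)) =
            \<mu> * (\<mu> + 2 * real t + 1) * (\<mu>\<^sup>2 + 2 * real t * \<mu> + \<mu> + (real t)\<^sup>2 - real t) / (real t)\<^sup>2
        \<and> real r = \<mu> * (\<mu>\<^sup>2 + 2 * real t * \<mu> + \<mu> + (real t)\<^sup>2) / real t"
proof -
  define c where "c = card {w \<in> W. x \<sim> w \<and> u \<sim> w}"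
  \<comment> \<open>The truncated subtraction is exact because \<open>t\<close> is positive; the
    choice of the pair makes \<open>k\<close> positive.\<close>
  define k where "k = t - of_bool (x \<sim> u)"
  have k: "k > 0" "real k = real t - of_bool (x \<sim> u)"
    using xu(4) t_pos by (auto simp: k_def of_bool_def)
  have ck: "real c = \<mu> * real k" using common_neighbours[OF xu(1-3)] by (simp add: c_def k)
  then have \<mu>k: "\<mu> = real c / real k" using k(1) by simp
  then have "\<mu> \<ge> 0" by simp
  with \<mu>_nonzero have \<mu>pos: "\<mu> > 0" by simp
  have "\<mu> \<in> \<int>"
  proof (rule rational_monic_quadratic_root_Ints)
    show "\<mu> \<in> \<rat>" unfolding \<mu>k by simp
    show "\<mu>\<^sup>2 + of_int (int t) * \<mu> = of_int (int b)"
      using quadratic_b by (simp add: algebra_simps power2_eq_square)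
  qed
  then obtain z where z: "\<mu> = of_int z" by (auto simp: Ints_def)
  then have "\<mu> = real (nat z)" "nat z > 0" using \<mu>pos by auto
  then have int: "\<exists>m::nat. m > 0 \<and> \<mu> = real m" by blast
  have tpos: "real t > 0" using t_pos by simp
  have ts: "real t * real s = \<mu> * ((\<mu> + real t)\<^sup>2 + \<mu>)"
    using quadratic_s unfolding quadratic_b by (simp add: algebra_simps power2_eq_square)
  then have rr: "real r = \<mu> * (\<mu>\<^sup>2 + 2 * real t * \<mu> + \<mu> + (real t)\<^sup>2) / real t"
    using tpos r_eq_s by (simp add: field_simps power2_eq_square)
  have cnt: "real (card X) * real b = real s * (real s - real t)"
    using card_X_times_b t_less_s by (metis of_nat_diff of_nat_mult less_imp_le)
  \<comment> \<open>Scaling the edge count by \<open>t^2\<close> lets \<open>s\<close> enter only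
    through \<open>t * s\<close>, a polynomial in \<mu> and \<open>t\<close>.\<close>
  have "(real t)\<^sup>2 * real (card X) * real b = (real t * real s) * (real t * real s - (real t)\<^sup>2)"
    using arg_cong[OF cnt, of "\<lambda>z. (real t)\<^sup>2 * z"] by (simp add: algebra_simps power2_eq_square)
  \<comment> \<open>\<open>t * s\<close> has the factor \<mu> and \<open>t * s - t^2\<close> the
    factor \<open>\<mu> + t\<close>; their product is \<open>b\<close>, which cancels.\<close>
  also have "\<dots> = ((\<mu> + real t)\<^sup>2 + \<mu>) * (\<mu>\<^sup>2 + real t * \<mu> + \<mu> - real t) * real b"
    unfolding ts quadratic_b by (simp add: algebra_simps power2_eq_square)
  finally have "(real t)\<^sup>2 * real (card X)
      = ((\<mu> + real t)\<^sup>2 + \<mu>) * (\<mu>\<^sup>2 + real t * \<mu> + \<mu> - real t)"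
    using b_pos by simp
  then have "(real t)\<^sup>2 * real (card (verts G)) = (real t)\<^sup>2 * real t + real t * (real t * real s)
      + ((\<mu> + real t)\<^sup>2 + \<mu>) * (\<mu>\<^sup>2 + real t * \<mu> + \<mu> - real t)"
    unfolding card_verts by (simp add: algebra_simps power2_eq_square)
  also have "\<dots> = \<mu> * (\<mu> + 2 * real t + 1) * (\<mu>\<^sup>2 + 2 * real t * \<mu> + \<mu> + (real t)\<^sup>2 - real t)"
    unfolding ts by (simp add: algebra_simps power2_eq_square)
  finally have "real (card (verts G)) =
      \<mu> * (\<mu> + 2 * real t + 1) * (\<mu>\<^sup>2 + 2 * real t * \<mu> + \<mu> + (real t)\<^sup>2 - real t) / (real t)\<^sup>2"
    using tpos by (simp add: eq_divide_eq mult.commute)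
  with int r_eq_s rr regular show ?thesis by blast
qed

text \<open>For \<open>t = 1\<close>, adjacent vertices of \<open>X\<close> have no common neighbour
  in \<open>W\<close>. The counts then force two vertices each in \<open>X\<close> and
  \<open>W\<close>, joined by a matching, and the one vertex of \<open>V\<close> closes the
  cycle.\<close>

lemma clique_case:
  assumes t1: "t = 1" and X2: "card X \<ge> 2"
    and clique: "\<And>x y. x \<in> X \<Longrightarrow> y \<in> X \<Longrightarrow> x \<noteq> y \<Longrightarrow> x \<sim> y"
  shows "(\<mu> = (-1 + sqrt 5) / 2 \<or> \<mu> = (-1 - sqrt 5) / 2) \<and> t = 1 \<and> r = s \<and> s = 2 \<and> cycle_graph 5 G"
proof -
  have uniq: "x = y" if "x \<in> X" "y \<in> X" "w \<in> W" "w \<sim> x" "w \<sim> y" for x y w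
  proof (rule ccontr)
    assume "x \<noteq> y"
    then have "card {w \<in> W. x \<sim> w \<and> y \<sim> w} = 0"
      using common_neighbours[OF that(1,2)] clique that t1 by simp
    then show False using that finite_VWX sym by (auto simp: card_eq_0_iff)
  qed
  have "card {x \<in> X. w \<sim> x} \<le> 1" if "w \<in> W" for w
    using uniq that finite_VWX by (auto simp: card_le_Suc0_iff_eq)
  moreover obtain w where "w \<in> W" using t_less_s card_W by fastforce
  \<comment> \<open>A vertex of \<open>W\<close> has degree \<open>s > 1\<close>, one neighbour in
    \<open>V\<close> and at most one in \<open>X\<close>.\<close>
  ultimately have s2: "s = 2" using degree_W[of w] t_less_s t1 by force
  have Xb: "card X * b = 2" using card_X_times_b s2 t1 by simp
  have "b < 2"
  proof (rule ccontr)
    assume "\<not> b < 2"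
    then have "2 * 2 \<le> card X * b" using X2 by (intro mult_le_mono) auto
    with Xb show False by simp
  qed
  with b_pos have b1: "b = 1" by linarith
  with Xb have cX: "card X = 2" by simp
  \<comment> \<open>Completing the square in \<open>quadratic_b\<close>, which reads \<mu>^2 + \<mu>
    = 1.\<close>
  have "(2 * \<mu> + 1)\<^sup>2 = 5" using quadratic_b b1 t1 by (simp add: algebra_simps power2_eq_square)
  then have "2 * \<mu> + 1 = sqrt 5 \<or> 2 * \<mu> + 1 = - sqrt 5"
    by (metis real_sqrt_abs abs_if minus_minus)
  then have gold: "\<mu> = (-1 + sqrt 5) / 2 \<or> \<mu> = (-1 - sqrt 5) / 2" by auto
  obtain v where v: "V = {v}" using card_V t1 by (auto simp: card_1_singleton_iff)
  obtain w1 w2 where w: "W = {w1, w2}" "w1 \<noteq> w2" using card_W s2 by (auto simp: card_2_iff)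
  have ex: "\<exists>x\<in>X. w \<sim> x" if "w \<in> W" for w
  proof -
    have "card {x \<in> X. w \<sim> x} = 1" using degree_W[OF that] s2 t1 by simp
    then have "{x \<in> X. w \<sim> x} \<noteq> {}" by (metis card.empty zero_neq_one)
    then show ?thesis by blast
  qed
  obtain u1 where u1: "u1 \<in> X" "w1 \<sim> u1" using ex w by blast
  obtain u2 where u2: "u2 \<in> X" "w2 \<sim> u2" using ex w by blast
  \<comment> \<open>Since \<open>b = 1\<close>, no vertex of \<open>X\<close> sees both
    \<open>w1\<close> and \<open>w2\<close>; this separates \<open>u1\<close> from
    \<open>u2\<close>.\<close>
  have once: "w1 = w2" if "x \<in> X" "x \<sim> w1" "x \<sim> w2" for x
  proof -
    have "card {w \<in> W. x \<sim> w} \<le> Suc 0" using card_XW[OF that(1)] b1 by simp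
    moreover have "finite {w \<in> W. x \<sim> w}" using finite_VWX by simp
    ultimately have "\<forall>y\<in>{w \<in> W. x \<sim> w}. \<forall>z\<in>{w \<in> W. x \<sim> w}. y = z"
      by (simp only: card_le_Suc0_iff_eq)
    then show ?thesis using that w(1) by blast
  qed
  have u12: "u1 \<noteq> u2" using once u1 u2 sym w by blast
  then have Xu: "X = {u1, u2}" using cX u1 u2 finite_VWX by (intro card_seteq[symmetric]) auto
  have dist: "distinct [v, w1, u1, u2, w2]"
    using X_disjoint VW_partition(2) v w Xu u12 by auto
  have vs: "verts G = {v, w1, u1, u2, w2}" using verts_eq v w Xu by auto
  have "cycle_graph 5 G"
    unfolding cycle_graph_def
  proof (intro conjI exI)
    \<comment> \<open>The vertices in cyclic order; the last one, \<open>w2\<close>, is joined back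
      to \<open>v\<close>.\<close>
    let ?c = "nth [v, w1, u1, u2, w2]"
    show "bij_betw ?c {..<5} (verts G)"
      using bij_betw_nth[OF dist, of "{..<5}" "verts G"] vs by simp
    have pos: "v \<sim> w1" "v \<sim> w2" "w1 \<sim> u1" "w2 \<sim> u2" "u1 \<sim> u2"
      using adjacent_VW_iff[of v w1] adjacent_VW_iff[of v w2] v w u1 u2 clique[OF u1(1) u2(1) u12]
      by simp_all
    have "\<not> w1 \<sim> u2" "\<not> w2 \<sim> u1"
      using uniq[OF u1(1) u2(1) _ u1(2)] uniq[OF u2(1) u1(1) _ u2(2)] u12 w(1) by auto
    moreover have "\<not> v \<sim> u1" "\<not> v \<sim> u2"
      using not_adjacent_XV(2) u1(1) u2(1) v by simp_all
    moreover have "\<not> w1 \<sim> w2"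
      using adjacent_VW_iff[of w1 w2] w(1) VW_partition(2) by auto
    \<comment> \<open>With the five edges in \<open>pos\<close>, these non-edges settle all ten
      pairs of vertices.\<close>
    ultimately have ne: "\<not> w1 \<sim> u2" "\<not> w2 \<sim> u1" "\<not> v \<sim> u1" "\<not> v \<sim> u2" "\<not> w1 \<sim> w2"
      by simp_all
    have "arcs_ends G = {(v, w1), (w1, v), (w1, u1), (u1, w1), (u1, u2), (u2, u1),
        (u2, w2), (w2, u2), (w2, v), (v, w2)}"
    proof (intro equalityI subrelI)
      fix x y assume "x \<sim> y"
      then have "x \<in> {v, w1, u1, u2, w2}" "y \<in> {v, w1, u1, u2, w2}"
        using adjacent_in_verts vs by auto
      with \<open>x \<sim> y\<close> show "(x, y) \<in> {(v, w1), (w1, v), (w1, u1), (u1, w1), (u1, u2), (u2, u1),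
        (u2, w2), (w2, u2), (w2, v), (v, w2)}"
        using ne sym[of x y] irrefl[of x] by auto
    next
      fix x y assume "(x, y) \<in> {(v, w1), (w1, v), (w1, u1), (u1, w1), (u1, u2), (u2, u1),
        (u2, w2), (w2, u2), (w2, v), (v, w2)}"
      then show "x \<sim> y" using pos sym[of x y] by auto
    qed
    moreover have "{..<5::nat} = {0, 1, 2, 3, 4}" by auto
    ultimately show "arcs_ends G = (\<Union>i<5. {(?c i, ?c ((i + 1) mod 5)), (?c ((i + 1) mod 5), ?c i)})"
      by auto
  qed (use graph in auto)
  with gold t1 r_eq_s s2 show ?thesis by blast
qed

end

theorem theorem3p7:
  fixes G :: "('a, 'b) pre_digraph" and X V W :: "'a set"
    and s t r :: nat and \<mu> :: real
  assumes "s \<ge> t" and "t \<ge> 1"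
    and "graph G" and "regular_graph G r"
    and "star_set G \<mu> X"
    and "complete_bipartition (delete_verts G X) V W" and "card V = t" and "card W = s"
    and "\<mu> \<notin> {-1, - real t, real r}"
    and "\<exists>b. \<forall>u \<in> X. vertex_of_type G V W u (0, b)"
  shows
    "(\<mu> = - real r \<and> r = s \<and> s = t + 1 \<and> complete_bipartite_digraph (t + 1) (t + 1) G)
   \<or> ((\<mu> = (-1 + sqrt 5) / 2 \<or> \<mu> = (-1 - sqrt 5) / 2) \<and> t = 1 \<and> r = s \<and> s = 2
        \<and> cycle_graph 5 G)
   \<or> ((\<exists>m::nat. m > 0 \<and> \<mu> = real m) \<and> r = s \<and> regular_graph G r
        \<and> real (card (verts G)) =
            \<mu> * (\<mu> + 2 * real t + 1) * (\<mu>\<^sup>2 + 2 * real t * \<mu> + \<mu> + (real t)\<^sup>2 - real t) / (real t)\<^sup>2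
        \<and> real r = \<mu> * (\<mu>\<^sup>2 + 2 * real t * \<mu> + \<mu> + (real t)\<^sup>2) / real t)"
proof -
  obtain b where "\<And>u. u \<in> X \<Longrightarrow> vertex_of_type G V W u (0, b)" using assms(10) by blast
  then interpret type_zero_star_complement G X V W s t r b \<mu>
    using assms by unfold_locales auto
  \<comment> \<open>Once a single vertex is set aside, the question is whether some pair in
    \<open>X\<close> has a positive factor \<open>t - a\<close>; if none has, then
    \<open>t = 1\<close> and \<open>X\<close> is a clique.\<close>
  consider (single) "card X = 1" | (integral) x u where "x \<in> X" "u \<in> X" "x \<noteq> u" "t \<ge> 2 \<or> \<not> x \<sim> u"
    | (clique) "t = 1" "card X \<ge> 2" "\<And>x y. x \<in> X \<Longrightarrow> y \<in> X \<Longrightarrow> x \<noteq> y \<Longrightarrow> x \<sim> y"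
  proof (cases "card X = 1")
    case False
    then have X2: "card X \<ge> 2" using card_X_pos by linarith
    then have "\<not> card X \<le> Suc 0" by simp
    then obtain x u where xu: "x \<in> X" "u \<in> X" "x \<noteq> u" using card_le_Suc0_iff_eq[OF finite_VWX(3)] by blast
    have "t \<ge> 2 \<or> t = 1" using t_pos by linarith
    then show thesis using that(2,3) xu X2 by blast
  qed (use that in blast)
  then show ?thesis
  proof cases
    case single
    from singleton_case[OF this] show ?thesis by blast
  next
    case integral
    from integral_case[OF this] show ?thesis by blast
  next
    case clique
    from clique_case[OF this] show ?thesis by blast
  qed
qed

end
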